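(* Let $A$ be a formula of $L$ and $\Gamma$ a set of formulas of $L$. If $A$ is a DI9 logical consequence of $\Gamma$, then $A$ is a tautological consequence of $\Gamma$ in the sense of classical semantics.
   Context: $L$ is a standard language of classical propositional logic: its formulas are built recursively from an infinite set of atomic formulas by the primitive connectives negation ($\sim$) and disjunction ($\vee$). "Number" means real number. There are three distinct values $T, F, 0$; $T$ and $F$ are called truth values. A DI9 valuation for $L$ is a function $\alpha$ from (atomic formulas of $L$) $\times\ \mathbb{R}$ to $\{T,F,0\}$ such that for every atomic formula $A$: (1) for all numbers $j<h$, if $\alpha(A,j)=T$ then $\alpha(A,h)=T$, and if $\alpha(A,j)=F$ then $\alpha(A,h)=F$; (2) there is a number $j$ with $\alpha(A,j)=T$ or $\alpha(A,j)=F$. For a DI9 valuation $\alpha$, the DI9 classical interpretation associated to $\alpha$ is the function $\alpha^*$ from formulas of $L$ to $\{T,F\}$ such that: for atomic $A$, $\alpha^*(A)=T$ iff there is a $j$ with $\alpha(A,j)=T$; $\alpha^*(\sim B)=T$ iff $\alpha^*(B)=F$; $\alpha^*(B\vee C)=T$ iff $\alpha^*(B)=T$ or $\alpha^*(C)=T$. For a number $j$, a DI9 valuation $\beta$ is a $j$-extension of a DI9 valuation $\alpha$ iff $\beta(A,h)=\alpha(A,h)$ for every atomic formula $A$ and every number $h\le j$. For a DI9 valuation $\alpha$, the DI9 interpretation $I\alpha$ is the function from (formulas of $L$) $\times\ \mathbb{R}$ to $\{T,F,0\}$ defined recursively by: $I\alpha(A,j)=\alpha(A,j)$ for atomic $A$;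 $I\alpha(\sim B,j)=T$ iff $I\alpha(B,j)=F$, $I\alpha(\sim B,j)=F$ iff $I\alpha(B,j)=T$, $I\alpha(\sim B,j)=0$ iff $I\alpha(B,j)=0$; $I\alpha(B\vee C,j)=T$ iff for every $j$-extension $\beta$ of $\alpha$, $\beta^*(B)=T$ or $\beta^*(C)=T$; $I\alpha(B\vee C,j)=F$ iff for every $j$-extension $\beta$ of $\alpha$, $\beta^*(B)=F$ and $\beta^*(C)=F$; and $I\alpha(B\vee C,j)=0$ otherwise. $I\alpha$ satisfies a formula $A$ at a number $j$ iff $I\alpha(A,j)=T$. A formula $A$ is a DI9 logical consequence of a set $\Gamma$ of formulas iff, for every number $j$, every DI9 interpretation for $L$ that satisfies all elements of $\Gamma$ at $j$ also satisfies $A$ at $j$. An interpretation for $L$ in the sense of classical semantics is a function $v$ from formulas of $L$ to $\{T,F\}$ with $v(\sim B)=T$ iff $v(B)=F$, and $v(B\vee C)=T$ iff $v(B)=T$ or $v(C)=T$. $A$ is a tautological consequence of $\Gamma$ iff every such $v$ with $v(B)=T$ for all $B\in\Gamma$ has $v(A)=T$. *)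

theory Defs
  imports Complex_Main
begin

datatype val = T | F | Zero

datatype 'a form = Atom 'a | Neg "'a form" | Disj "'a form" "'a form"

definition DI9_valuation :: "('a \<Rightarrow> real \<Rightarrow> val) \<Rightarrow> bool" where
  "DI9_valuation \<alpha> \<longleftrightarrow>
    (\<forall>a. (\<forall>j h. j < h \<longrightarrow> (\<alpha> a j = T \<longrightarrow> \<alpha> a h = T) \<and> (\<alpha> a j = F \<longrightarrow> \<alpha> a h = F)) \<and>
         (\<exists>j. \<alpha> a j = T \<or> \<alpha> a j = F))"

primrec DI9_classical :: "('a \<Rightarrow> real \<Rightarrow> val) \<Rightarrow> 'a form \<Rightarrow> val" where
  "DI9_classical \<alpha> (Atom a) = (if \<exists>j. \<alpha> a j = T then T else F)"
| "DI9_classical \<alpha> (Neg B) = (if DI9_classical \<alpha> B = F then T else F)"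
| "DI9_classical \<alpha> (Disj B C) =
    (if DI9_classical \<alpha> B = T \<or> DI9_classical \<alpha> C = T then T else F)"

lemma DI9_classical_truth_value: "DI9_classical \<alpha> B \<in> {T, F}"
  by (cases B) auto

definition DI9_extension :: "real \<Rightarrow> ('a \<Rightarrow> real \<Rightarrow> val) \<Rightarrow> ('a \<Rightarrow> real \<Rightarrow> val) \<Rightarrow> bool" where
  "DI9_extension j \<alpha> \<beta> \<longleftrightarrow> DI9_valuation \<beta> \<and> (\<forall>a. \<forall>h\<le>j. \<beta> a h = \<alpha> a h)"

primrec DI9_interp :: "('a \<Rightarrow> real \<Rightarrow> val) \<Rightarrow> 'a form \<Rightarrow> real \<Rightarrow> val" where
  "DI9_interp \<alpha> (Atom a) j = \<alpha> a j"
| "DI9_interp \<alpha> (Neg B) j =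
    (case DI9_interp \<alpha> B j of T \<Rightarrow> F | F \<Rightarrow> T | Zero \<Rightarrow> Zero)"
| "DI9_interp \<alpha> (Disj B C) j =
    (if \<forall>\<beta>. DI9_extension j \<alpha> \<beta> \<longrightarrow> DI9_classical \<beta> B = T \<or> DI9_classical \<beta> C = T then T
     else if \<forall>\<beta>. DI9_extension j \<alpha> \<beta> \<longrightarrow> DI9_classical \<beta> B = F \<and> DI9_classical \<beta> C = F then F
     else Zero)"

text \<open>The order of the two tests in the disjunction clause is immaterial for a valuation:
  it extends itself, so the two conditions exclude each other.\<close>

lemma DI9_interp_Disj_eq_F:
  assumes "DI9_valuation \<alpha>"
  shows "DI9_interp \<alpha> (Disj B C) j = F \<longleftrightarrow>
    (\<forall>\<beta>. DI9_extension j \<alpha> \<beta> \<longrightarrow> DI9_classical \<beta> B = F \<and> DI9_classical \<beta> C = F)"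
proof -
  have "DI9_extension j \<alpha> \<alpha>"
    using assms by (simp add: DI9_extension_def)
  then show ?thesis
    by auto
qed

definition DI9_satisfies :: "('a form \<Rightarrow> real \<Rightarrow> val) \<Rightarrow> 'a form \<Rightarrow> real \<Rightarrow> bool" where
  "DI9_satisfies I A j \<longleftrightarrow> I A j = T"

definition DI9_consequence :: "'a form set \<Rightarrow> 'a form \<Rightarrow> bool" where
  "DI9_consequence \<Gamma> A \<longleftrightarrow>
    (\<forall>j \<alpha>. DI9_valuation \<alpha> \<longrightarrow> (\<forall>B\<in>\<Gamma>. DI9_satisfies (DI9_interp \<alpha>) B j) \<longrightarrow>
      DI9_satisfies (DI9_interp \<alpha>) A j)"

definition classical_interpretation :: "('a form \<Rightarrow> val) \<Rightarrow> bool" where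
  "classical_interpretation v \<longleftrightarrow>
    (\<forall>B. v B \<in> {T, F}) \<and>
    (\<forall>B. v (Neg B) = T \<longleftrightarrow> v B = F) \<and>
    (\<forall>B C. v (Disj B C) = T \<longleftrightarrow> v B = T \<or> v C = T)"

definition tautological_consequence :: "'a form set \<Rightarrow> 'a form \<Rightarrow> bool" where
  "tautological_consequence \<Gamma> A \<longleftrightarrow>
    (\<forall>v. classical_interpretation v \<longrightarrow> (\<forall>B\<in>\<Gamma>. v B = T) \<longrightarrow> v A = T)"

end

(* A classical interpretation v induces the valuation that takes the value v(A) on every atom A
   at all times.  All atoms being decided at j, every j-extension has v as its classical
   interpretation, so the DI9 interpretation at j is v itself. *)
theory Submission
  imports Defs
begin

lemma classical_interpretation_Neg:
  assumes "classical_interpretation v"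
  shows "v (Neg B) = (if v B = F then T else F)"
  using assms unfolding classical_interpretation_def by (metis insert_iff singletonD)

lemma classical_interpretation_Disj:
  assumes "classical_interpretation v"
  shows "v (Disj B C) = (if v B = T \<or> v C = T then T else F)"
  using assms unfolding classical_interpretation_def by (metis insert_iff singletonD)

lemma classical_interpretation_cases:
  assumes "classical_interpretation v"
  obtains "v B = T" | "v B = F"
  using assms unfolding classical_interpretation_def by blast

text \<open>Both truth values persist, so T at some time and F at \<open>j\<close> would clash at
  the later of the two; with \<open>Zero\<close> excluded at \<open>j\<close>, only T remains
  there.\<close>

lemma DI9_valuation_eq_T_iff:
  assumes "DI9_valuation \<beta>" and "\<beta> a j \<noteq> Zero"
  shows "(\<exists>h. \<beta> a h = T) \<longleftrightarrow> \<beta> a j = T"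
proof
  assume "\<exists>h. \<beta> a h = T"
  then obtain h where h: "\<beta> a h = T" ..
  show "\<beta> a j = T"
  proof (rule ccontr)
    assume "\<beta> a j \<noteq> T"
    with assms(2) have "\<beta> a j = F"
      by (cases "\<beta> a j") auto
    with h show False
      using assms(1) unfolding DI9_valuation_def by (metis linorder_neqE val.distinct(1))
  qed
qed blast

text \<open>Only the values of \<beta> at the single time \<open>j\<close> are prescribed, so that
  this applies to arbitrary \<open>j\<close>-extensions, not just to valuations constant in time. As
  \<open>v\<close> is two-valued, every atom is decided at \<open>j\<close>, which fixes its
  classical value; the connectives then follow the same truth tables.\<close>

lemma DI9_classical_eq_classical_interpretation:
  assumes v: "classical_interpretation v" and \<beta>: "DI9_valuation \<beta>"
    and atoms: "\<And>a. \<beta> a j = v (Atom a)"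
  shows "DI9_classical \<beta> B = v B"
proof (induction B)
  case (Atom a)
  show ?case
    using DI9_valuation_eq_T_iff[OF \<beta>, of a j] atoms[of a]
    by (cases rule: classical_interpretation_cases[OF v, of "Atom a"]) auto
qed (simp_all add: classical_interpretation_Neg[OF v] classical_interpretation_Disj[OF v])

lemma DI9_interp_eq_classical_interpretation:
  assumes v: "classical_interpretation v" and \<alpha>: "DI9_valuation \<alpha>"
    and atoms: "\<And>a. \<alpha> a j = v (Atom a)"
  shows "DI9_interp \<alpha> B j = v B"
proof (induction B)
  case (Atom a)
  show ?case
    by (simp add: atoms)
next
  case (Neg B)
  then show ?case
    by (cases rule: classical_interpretation_cases[OF v, of B])
      (simp_all add: classical_interpretation_Neg[OF v])
next
  case (Disj B C)
  \<comment> \<open>An extension agrees with \<alpha> at \<open>j\<close> itself, since the bound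
    \<open>h \<le> j\<close> is not strict, so it inherits \<open>atoms\<close>.\<close>
  have ext: "DI9_classical \<beta> D = v D" if "DI9_extension j \<alpha> \<beta>" for \<beta> D
    using that atoms unfolding DI9_extension_def
    by (intro DI9_classical_eq_classical_interpretation[OF v, where j = j]) auto
  \<comment> \<open>When \<open>v\<close> makes both disjuncts false, some extension must refute the
    first test of the disjunction clause, which would otherwise hold vacuously; \<alpha> itself is
    one.\<close>
  have "DI9_extension j \<alpha> \<alpha>"
    using \<alpha> by (simp add: DI9_extension_def)
  then show ?case
    by (cases rule: classical_interpretation_cases[OF v, of B];
        cases rule: classical_interpretation_cases[OF v, of C])
      (auto simp: ext classical_interpretation_Disj[OF v])
qed

theorem proposition8:
  fixes A :: "'a form" and \<Gamma> :: "'a form set"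
  assumes "infinite (UNIV :: 'a set)"
    and "DI9_consequence \<Gamma> A"
  shows "tautological_consequence \<Gamma> A"
  unfolding tautological_consequence_def
proof (intro allI impI)
  fix v :: "'a form \<Rightarrow> val"
  assume v: "classical_interpretation v" and \<Gamma>: "\<forall>B\<in>\<Gamma>. v B = T"
  define \<alpha> :: "'a \<Rightarrow> real \<Rightarrow> val" where "\<alpha> = (\<lambda>a _. v (Atom a))"
  have \<alpha>: "DI9_valuation \<alpha>"
    using v by (auto simp: DI9_valuation_def \<alpha>_def classical_interpretation_def)
  \<comment> \<open>The time 0 is an arbitrary choice, as \<alpha> is constant in time.\<close>
  have interp: "DI9_interp \<alpha> B 0 = v B" for B
    by (rule DI9_interp_eq_classical_interpretation[OF v \<alpha>]) (simp add: \<alpha>_def)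
  show "v A = T"
    using assms(2) \<alpha> \<Gamma> interp unfolding DI9_consequence_def DI9_satisfies_def by metis
qed

end
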